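(* For $r \geq 2$ and $n_1 \geq n_2 \geq \cdots \geq n_r \geq 2$, the complete multipartite graph $K_{n_1,n_2,\dots,n_r}$ satisfies $\mathrm{tp}(K_{n_1,\dots,n_r}) = \mathrm{tp}^-(K_{n_1,\dots,n_r}) = r$.
   Context: $K_{n_1,\dots,n_r}$ is the complete multipartite graph whose vertex set is partitioned into independent sets of sizes $n_1,\dots,n_r$, with two vertices adjacent iff they lie in different parts. A set $S \subseteq V(G)$ is in general position if no shortest path of $G$ contains three vertices of $S$. A terminal set of $G$ is a general position set $S$ that is maximal under inclusion and such that for every $u \in V(G)\setminus S$ there is a shortest path of $G$ with $u$ as an endpoint containing at least two vertices of $S$. $\mathrm{tp}(G)$ and $\mathrm{tp}^-(G)$ are the orders of a largest and a smallest terminal set, respectively. *)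

theory Defs
  imports "Graph_Theory.Graph_Theory" "HOL-Library.Disjoint_Sets"
begin

text \<open>
  Following \<^theory>\<open>Graph_Theory.Kuratowski\<close>, simple graphs are finite symmetric loop-free digraphs
  without parallel arcs (locale \<^locale>\<open>graph\<close>), and a family such as $K_{n_1,\dots,n_r}$ is a
  predicate on graphs, so that statements about it hold for every isomorphic copy. The part sizes
  are \<open>n 1, \<dots>, n r\<close>; values of \<open>n\<close> and \<open>P\<close> outside \<open>{1..r}\<close> are irrelevant.
\<close>

definition complete_multipartite_digraph ::
    "nat \<Rightarrow> (nat \<Rightarrow> nat) \<Rightarrow> ('a, 'b) pre_digraph \<Rightarrow> bool" where
  "complete_multipartite_digraph r n G \<longleftrightarrow> graph G \<and>
    (\<exists>P. verts G = (\<Union>i\<in>{1..r}. P i) \<and> disjoint_family_on P {1..r} \<and>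
      (\<forall>i\<in>{1..r}. card (P i) = n i) \<and>
      arcs_ends G = {(u, v). \<exists>i\<in>{1..r}. \<exists>j\<in>{1..r}. i \<noteq> j \<and> u \<in> P i \<and> v \<in> P j})"

definition shortest_vpath :: "('a, 'b) pre_digraph \<Rightarrow> 'a list \<Rightarrow> bool" where
  "shortest_vpath G p \<longleftrightarrow> vpath p G \<and>
    (\<forall>q. vpath q G \<and> hd q = hd p \<and> last q = last p \<longrightarrow> vwalk_length p \<le> vwalk_length q)"

definition general_position :: "('a, 'b) pre_digraph \<Rightarrow> 'a set \<Rightarrow> bool" where
  "general_position G S \<longleftrightarrow> S \<subseteq> verts G \<and>
    \<not> (\<exists>p. shortest_vpath G p \<and> card (set p \<inter> S) \<ge> 3)"

definition terminal_set :: "('a, 'b) pre_digraph \<Rightarrow> 'a set \<Rightarrow> bool" where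
  "terminal_set G S \<longleftrightarrow> general_position G S \<and>
    (\<forall>T. general_position G T \<and> S \<subseteq> T \<longrightarrow> T = S) \<and>
    (\<forall>u \<in> verts G - S. \<exists>p. shortest_vpath G p \<and> (hd p = u \<or> last p = u) \<and>
      card (set p \<inter> S) \<ge> 2)"

text \<open>
  \<^const>\<open>Max\<close> and \<^const>\<open>Min\<close> are unspecified on the empty set, so an equation \<open>tp G = k\<close> is only
  provable for graphs that have a terminal set.
\<close>

definition tp :: "('a, 'b) pre_digraph \<Rightarrow> nat" where
  "tp G = Max (card ` {S. terminal_set G S})"

definition tp_minus :: "('a, 'b) pre_digraph \<Rightarrow> nat" where
  "tp_minus G = Min (card ` {S. terminal_set G S})"

lemma complete_multipartite_digraph_exists:
  "\<exists>G :: (nat \<times> nat, (nat \<times> nat) \<times> (nat \<times> nat)) pre_digraph. complete_multipartite_digraph r n G"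
proof -
  define P where "P i = {i} \<times> {..<n i}" for i
  define V where "V = (\<Union>i\<in>{1..r}. P i)"
  define H where "H = \<lparr>pverts = V, parcs = {(u, v). u \<in> V \<and> v \<in> V \<and> fst u \<noteq> fst v}\<rparr>"
  have fin: "finite V" by (simp add: V_def P_def)
  have "parcs H \<subseteq> V \<times> V" by (auto simp: H_def)
  with fin have fin': "finite (parcs H)" by (meson finite_SigmaI finite_subset)
  interpret pair_graph H
    using fin fin' by unfold_locales (auto simp: H_def symmetric_def sym_def)
  have "graph (with_proj H)" by (rule pair_graphD_graph)
  moreover have "parcs H = {(u, v). \<exists>i\<in>{1..r}. \<exists>j\<in>{1..r}. i \<noteq> j \<and> u \<in> P i \<and> v \<in> P j}"
    by (fastforce simp: H_def V_def P_def)
  moreover have "pverts H = (\<Union>i\<in>{1..r}. P i)" by (simp add: H_def V_def)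
  moreover have "disjoint_family_on P {1..r}" "\<forall>i\<in>{1..r}. card (P i) = n i"
    by (auto simp: disjoint_family_on_def P_def)
  ultimately show ?thesis
    unfolding complete_multipartite_digraph_def
    by (intro exI[of _ "with_proj H"] conjI exI[of _ P]) simp_all
qed

end

theory Submission
  imports Defs
begin

text \<open>
  A shortest path of a complete multipartite graph has at most three vertices, and with exactly
  three its ends lie in one part and its middle vertex in another. So a set in general position
  either lies inside one part or meets every part in at most one vertex. A set inside a part that
  is not such a partial transversal fails the endpoint condition at any vertex of another part,
  while the maximal partial transversals are the full ones, and those are terminal sets.
\<close>

lemma shortest_vpath_length_le:
  assumes "shortest_vpath G p" "vpath q G" "hd q = hd p" "last q = last p"
  shows "length p \<le> length q"
proof -
  \<comment> \<open>\<open>vwalk_length\<close> counts arcs, so it cannot tell \<open>[]\<close>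
    from a one-vertex walk; nonemptiness allows passing to numbers of vertices.\<close>
  have "length p - 1 \<le> length q - 1" "p \<noteq> []" "q \<noteq> []"
    using assms by (auto simp: shortest_vpath_def vpath_def vwalk_def)
  then show ?thesis by (cases p; cases q) auto
qed

text \<open>\<open>c\<close> assigns to each vertex the index of its part.\<close>

locale complete_multipartite_parts =
  fixes G :: "('a, 'b) pre_digraph" and c :: "'a \<Rightarrow> 'k"
  assumes arcs_ends_iff: "(u, v) \<in> arcs_ends G \<longleftrightarrow> u \<in> verts G \<and> v \<in> verts G \<and> c u \<noteq> c v"
    and other_part: "u \<in> verts G \<Longrightarrow> \<exists>v\<in>verts G. c v \<noteq> c u"
begin

lemma shortest_vpath_through_part:
  assumes "u \<in> verts G" "v \<in> verts G" "w \<in> verts G" "u \<noteq> w" "c u = c w" "c v \<noteq> c u"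
  shows "shortest_vpath G [u, v, w]"
proof -
  have "vwalk_length [u, v, w] \<le> vwalk_length q"
    if q: "vpath q G" "hd q = u" "last q = w" for q
  proof (rule ccontr)
    assume "\<not> ?thesis"
    then have len: "length q < 3" by simp
    show False
    proof (cases q)
      case Nil
      then show ?thesis using q by auto
    next
      case (Cons a q')
      \<comment> \<open>A competitor with fewer than three vertices and distinct ends can only be
        \<open>[u, w]\<close>, which is no walk because \<open>u\<close> and \<open>w\<close> share
        a part.\<close>
      then have q': "q' = [w]" using q len assms by (cases q') (auto split: if_splits)
      then show ?thesis using q Cons assms
        by (auto simp: vpath_def vwalk_def arcs_ends_iff)
    qed
  qed
  moreover have "vpath [u, v, w] G"
    using assms by (auto simp: vpath_def vwalk_def arcs_ends_iff)
  ultimately show ?thesis by (auto simp: shortest_vpath_def)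
qed

text \<open>The diameter is at most two: vertices of different parts are adjacent, and two vertices
  of one part have every vertex outside it as a common neighbour.\<close>

lemma shortest_vpath_cases:
  assumes p: "shortest_vpath G p"
  obtains "length p \<le> 2" "p \<noteq> []"
  | u v w where "p = [u, v, w]" "u \<noteq> w" "c u = c w" "c v \<noteq> c u"
proof -
  have walk: "vpath p G" using p by (simp add: shortest_vpath_def)
  then have ne: "p \<noteq> []" and sub: "set p \<subseteq> verts G"
    by (auto simp: vpath_def vwalk_def)
  define u w where "u = hd p" and "w = last p"
  have uw: "u \<in> verts G" "w \<in> verts G" using ne sub by (auto simp: u_def w_def)
  show thesis
  proof (cases "length p \<le> 2")
    case True
    then show ?thesis using ne that by blast
  next
    case False
    \<comment> \<open>Three competitors with the same ends as \<open>p\<close> are tried in turn: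
      \<open>[u]\<close> and \<open>[u, w]\<close> would be too short, and the detour
      \<open>[u, x, w]\<close> bounds the length of \<open>p\<close> by three.\<close>
    have "u \<noteq> w"
    proof
      assume "u = w"
      moreover have "vpath [u] G" using uw by (simp add: vpath_def vwalk_def)
      ultimately have "length p \<le> length [u]"
        by (intro shortest_vpath_length_le[OF p]) (auto simp: u_def w_def)
      then show False using False by simp
    qed
    have "c u = c w"
    proof (rule ccontr)
      assume "c u \<noteq> c w"
      then have "vpath [u, w] G" using uw \<open>u \<noteq> w\<close>
        by (auto simp: vpath_def vwalk_def arcs_ends_iff)
      then have "length p \<le> length [u, w]"
        by (intro shortest_vpath_length_le[OF p]) (auto simp: u_def w_def)
      then show False using False by simp
    qed
    obtain x where "x \<in> verts G" "c x \<noteq> c u" using other_part uw by blast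
    then have "vpath [u, x, w] G"
      using shortest_vpath_through_part uw \<open>u \<noteq> w\<close> \<open>c u = c w\<close>
      by (simp add: shortest_vpath_def)
    then have "length p \<le> length [u, x, w]"
      by (intro shortest_vpath_length_le[OF p]) (auto simp: u_def w_def)
    then have "length p = 3" using False by simp
    then obtain v where v: "p = [u, v, w]"
      by (auto simp: u_def w_def length_Suc_conv numeral_3_eq_3)
    then have "c v \<noteq> c u" using walk by (auto simp: vpath_def vwalk_def arcs_ends_iff)
    then show ?thesis using that v \<open>u \<noteq> w\<close> \<open>c u = c w\<close> by blast
  qed
qed

text \<open>The forbidden triples are two vertices of one part together with a vertex outside it.
  Hence, as soon as two elements of \<open>S\<close> share a part, that part must contain all of
  \<open>S\<close>.\<close>

lemma general_position_iff:
  "general_position G S \<longleftrightarrow> S \<subseteq> verts G \<and>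
    (\<forall>u\<in>S. \<forall>w\<in>S. u \<noteq> w \<and> c u = c w \<longrightarrow> (\<forall>v\<in>S. c v = c u))"
    (is "_ \<longleftrightarrow> _ \<and> ?inside")
proof
  assume S: "general_position G S"
  then have sub: "S \<subseteq> verts G" by (simp add: general_position_def)
  have ?inside
  proof (intro ballI impI, elim conjE, rule ccontr)
    fix u w v
    assume *: "u \<in> S" "w \<in> S" "u \<noteq> w" "c u = c w" "v \<in> S" "c v \<noteq> c u"
    then have "shortest_vpath G [u, v, w]"
      using sub by (intro shortest_vpath_through_part) auto
    moreover have "set [u, v, w] \<inter> S = {u, v, w}" using * by auto
    moreover have "v \<noteq> u" "v \<noteq> w" using * by auto
    then have "card {u, v, w} = 3" using * by simp
    ultimately show False using S unfolding general_position_def by (metis order_refl)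
  qed
  with sub show "S \<subseteq> verts G \<and> ?inside" ..
next
  assume S: "S \<subseteq> verts G \<and> ?inside"
  have "card (set p \<inter> S) < 3" if "shortest_vpath G p" for p
    using that
  proof (cases rule: shortest_vpath_cases)
    case 1
    have "card (set p \<inter> S) \<le> length p"
      by (meson List.finite_set card_length card_mono inf_le1 le_trans)
    then show ?thesis using 1 by simp
  next
    case (2 u v w)
    \<comment> \<open>If \<open>S\<close> contained all three, the common part of \<open>u\<close>
      and \<open>w\<close> would have to contain \<open>v\<close> too.\<close>
    have "\<not> {u, v, w} \<subseteq> S" using S 2(2-) unfolding insert_subset by blast
    then have "\<not> set p \<subseteq> S" using 2(1) by simp
    then have "set p \<inter> S \<subset> set p" by blast
    then have "card (set p \<inter> S) < card (set p)" by (simp add: psubset_card_mono)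
    then show ?thesis using card_length[of p] 2 by simp
  qed
  then show "general_position G S" using S unfolding general_position_def
    by (meson linorder_not_le)
qed

lemma general_position_if_inj_on:
  assumes "S \<subseteq> verts G" "inj_on c S"
  shows "general_position G S"
  using assms unfolding general_position_iff inj_on_def by blast

lemma terminal_set_imp_inj_on:
  assumes "terminal_set G S"
  shows "inj_on c S"
proof (rule inj_onI, rule ccontr)
  fix u w
  assume uw: "u \<in> S" "w \<in> S" "c u = c w" "u \<noteq> w"
  have "general_position G S" using assms by (simp add: terminal_set_def)
  then have "S \<subseteq> verts G" and part: "\<forall>v\<in>S. c v = c u"
    using uw unfolding general_position_iff by blast+
  then obtain x where x: "x \<in> verts G" "c x \<noteq> c u" using other_part uw by blast
  then have "x \<notin> S" using part by blast
  then obtain p where p: "shortest_vpath G p" "hd p = x \<or> last p = x" "card (set p \<inter> S) \<ge> 2"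
    using assms x unfolding terminal_set_def by blast
  \<comment> \<open>A path with at most two vertices loses \<open>x\<close>. In a path with three
    vertices both ends lie in the part of \<open>x\<close>, which misses \<open>S\<close>, so only
    the middle vertex can be in \<open>S\<close>.\<close>
  have "\<exists>y. set p \<inter> S \<subseteq> {y}"
    using p(1)
  proof (cases rule: shortest_vpath_cases)
    case 1
    then consider a where "p = [a]" | a b where "p = [a, b]"
      by (cases p; cases "tl p") auto
    then show ?thesis using p(2) \<open>x \<notin> S\<close> by cases auto
  next
    case (2 a b d)
    then show ?thesis using p(2) part x by auto
  qed
  then obtain y where "set p \<inter> S \<subseteq> {y}" ..
  then have "card (set p \<inter> S) \<le> card {y}" by (intro card_mono) auto
  then show False using p(3) by simp
qed

text \<open>A partial transversal that misses a part can be enlarged by any vertex of that part, so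
  maximality forces it to be full.\<close>

lemma terminal_set_iff_transversal:
  "terminal_set G S \<longleftrightarrow> S \<subseteq> verts G \<and> bij_betw c S (c ` verts G)"
proof
  assume S: "terminal_set G S"
  then have inj: "inj_on c S" by (rule terminal_set_imp_inj_on)
  have sub: "S \<subseteq> verts G"
    using S by (simp add: terminal_set_def general_position_def)
  have max: "T = S" if "general_position G T" "S \<subseteq> T" for T
    using S that unfolding terminal_set_def by blast
  have "c x \<in> c ` S" if x: "x \<in> verts G" for x
  proof (rule ccontr)
    assume *: "c x \<notin> c ` S"
    with inj have "inj_on c (insert x S)" by auto
    then have "general_position G (insert x S)"
      using sub x by (intro general_position_if_inj_on) auto
    then have "insert x S = S" by (intro max) auto
    with * show False by blast
  qed
  with inj sub show "S \<subseteq> verts G \<and> bij_betw c S (c ` verts G)"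
    by (auto simp: bij_betw_def)
next
  assume "S \<subseteq> verts G \<and> bij_betw c S (c ` verts G)"
  then have sub: "S \<subseteq> verts G" and inj: "inj_on c S" and im: "c ` S = c ` verts G"
    by (auto simp: bij_betw_def)
  have gp: "general_position G S"
    using sub inj by (rule general_position_if_inj_on)
  \<comment> \<open>For \<open>u\<close> outside \<open>S\<close>, the resulting triple serves
    twice: it is an obstruction to adding \<open>u\<close>, which gives maximality, and
    \<open>[u, v, w]\<close> is the path required by the endpoint condition.\<close>
  have same_other: "\<exists>w\<in>S. \<exists>v\<in>S. c w = c u \<and> c v \<noteq> c u" if u: "u \<in> verts G" for u
  proof -
    obtain v where "v \<in> verts G" "c v \<noteq> c u" using other_part u by blast
    then have "c u \<in> c ` S" "c v \<in> c ` S" using im u by auto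
    with \<open>c v \<noteq> c u\<close> show ?thesis by (metis imageE)
  qed
  have "T = S" if T: "general_position G T" "S \<subseteq> T" for T
  proof (rule ccontr)
    assume "T \<noteq> S"
    then obtain u where u: "u \<in> T" "u \<notin> S" using T by blast
    moreover have "u \<in> verts G" using T u by (auto simp: general_position_iff)
    ultimately show False
      using same_other[of u] T unfolding general_position_iff by (metis subsetD)
  qed
  moreover have "\<exists>p. shortest_vpath G p \<and> (hd p = u \<or> last p = u) \<and> card (set p \<inter> S) \<ge> 2"
    if u: "u \<in> verts G - S" for u
  proof -
    obtain w v where wv: "w \<in> S" "v \<in> S" "c w = c u" "c v \<noteq> c u"
      using same_other u by blast
    then have "shortest_vpath G [u, v, w]"
      using u sub by (intro shortest_vpath_through_part) auto
    moreover have "v \<noteq> w" "set [u, v, w] \<inter> S = {v, w}" using wv u by auto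
    ultimately show ?thesis by (intro exI[of _ "[u, v, w]"]) simp
  qed
  ultimately show "terminal_set G S" using gp unfolding terminal_set_def by blast
qed

text \<open>Having exactly one value, rather than at most one, is what determines both
  \<open>Max\<close> and \<open>Min\<close>.\<close>

lemma card_terminal_sets: "card ` {S. terminal_set G S} = {card (c ` verts G)}"
proof -
  \<comment> \<open>Choosing one vertex from each part gives a terminal set.\<close>
  obtain S where "S \<subseteq> verts G" "inj_on c S" "c ` S = c ` verts G"
    using subset_image_inj[of "c ` verts G" c "verts G"] by auto
  then have "terminal_set G S" by (simp add: terminal_set_iff_transversal bij_betw_def)
  moreover have "card T = card (c ` verts G)" if "terminal_set G T" for T
    using that by (auto simp: terminal_set_iff_transversal dest: bij_betw_same_card)
  ultimately show ?thesis by (auto simp: image_iff)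
qed

end

lemma complete_multipartite_digraph_parts:
  assumes G: "complete_multipartite_digraph r n G"
    and r: "r \<ge> 2" and n: "\<And>i. i \<in> {1..r} \<Longrightarrow> n i > 0"
  obtains c :: "'a \<Rightarrow> nat"
  where "complete_multipartite_parts (G :: ('a, 'b) pre_digraph) c" "c ` verts G = {1..r}"
proof -
  obtain P where verts: "verts G = (\<Union>i\<in>{1..r}. P i)" and disj: "disjoint_family_on P {1..r}"
    and card: "\<forall>i\<in>{1..r}. card (P i) = n i"
    and arcs: "arcs_ends G = {(u, v). \<exists>i\<in>{1..r}. \<exists>j\<in>{1..r}. i \<noteq> j \<and> u \<in> P i \<and> v \<in> P j}"
    using G unfolding complete_multipartite_digraph_def by blast
  \<comment> \<open>Disjointness of the parts makes this description unique on
    \<open>verts G\<close>; elsewhere the value is arbitrary.\<close>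
  define c where "c u = (THE i. i \<in> {1..r} \<and> u \<in> P i)" for u
  have c: "c u = i" if "i \<in> {1..r}" "u \<in> P i" for u i
    unfolding c_def using that disj
    by (intro the_equality) (auto dest: disjoint_family_onD)
  have P: "u \<in> P i \<longleftrightarrow> u \<in> verts G \<and> c u = i" if "i \<in> {1..r}" for u i
    using that c verts by auto
  have cin: "c u \<in> {1..r}" if "u \<in> verts G" for u using that c verts by auto
  have inhabited: "\<exists>u\<in>verts G. c u = i" if i: "i \<in> {1..r}" for i
  proof -
    have "P i \<noteq> {}" using n[OF i] card i by fastforce
    then show ?thesis using P[OF i] by blast
  qed
  have "complete_multipartite_parts G c"
  proof
    show "(u, v) \<in> arcs_ends G \<longleftrightarrow> u \<in> verts G \<and> v \<in> verts G \<and> c u \<noteq> c v" for u v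
      using cin P by (auto simp: arcs)
    show "\<exists>v\<in>verts G. c v \<noteq> c u" if "u \<in> verts G" for u
    proof -
      \<comment> \<open>Since there are at least two parts, one of the indices 1 and 2 differs from
        \<open>c u\<close>.\<close>
      have "(if c u = 1 then 2 else 1) \<in> {1..r}" using r by auto
      from inhabited[OF this] show ?thesis by (metis numeral_One numeral_eq_iff num.distinct(1))
    qed
  qed
  moreover have "c ` verts G = {1..r}" using cin inhabited by blast
  ultimately show thesis using that by blast
qed

theorem theorem4p4:
  fixes G :: "('a, 'b) pre_digraph" and r :: nat and n :: "nat \<Rightarrow> nat"
  assumes "r \<ge> 2"
    and "\<And>i j. 1 \<le> i \<Longrightarrow> i \<le> j \<Longrightarrow> j \<le> r \<Longrightarrow> n i \<ge> n j"
    and "n r \<ge> 2"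
    and "complete_multipartite_digraph r n G"
  shows "tp G = r \<and> tp_minus G = r"
proof -
  \<comment> \<open>The sizes are non-increasing, so the last one bounds all others from
    below.\<close>
  have "n i > 0" if "i \<in> {1..r}" for i using assms(2)[of i r] assms(3) that by auto
  then obtain c :: "'a \<Rightarrow> nat"
    where "complete_multipartite_parts G c" and c: "c ` verts G = {1..r}"
    using complete_multipartite_digraph_parts[OF assms(4,1)] by blast
  then interpret complete_multipartite_parts G c by simp
  show ?thesis by (simp add: tp_def tp_minus_def card_terminal_sets c)
qed

end
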